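(* Let $\mathfrak{h}_3(\mathbb{C})$ be the $3$-dimensional complex Heisenberg Lie algebra on $\mathbb{C}^3$, with canonical basis $\{e_1,e_2,e_3\}$ and only nonzero bracket (up to skew-symmetry) $[e_1,e_2]=e_3$. Any hom-Lie algebra $(\mathfrak{h}_3(\mathbb{C}),A)$ with $A$ a nilpotent operator is isomorphic to some hom-Lie algebra $\mathfrak{L}_1^i:=(\mathfrak{h}_3(\mathbb{C}),A_i)$, $i\in\{0,1,\dots,6\}$, where $A_0$ is the zero map and the matrices of the other $A_i$ with respect to the ordered basis $\{e_1,e_2,e_3\}$ are $$A_1=\begin{pmatrix}0&0&0\\0&0&0\\0&1&0\end{pmatrix},\quad A_2=\begin{pmatrix}0&1&0\\0&0&0\\0&0&0\end{pmatrix},\quad A_3=\begin{pmatrix}0&0&0\\0&0&1\\0&0&0\end{pmatrix},$$ $$A_4=\begin{pmatrix}0&1&0\\0&0&1\\0&0&0\end{pmatrix},\quad A_5=\begin{pmatrix}0&0&0\\1&0&0\\0&1&0\end{pmatrix},\quad A_6=\begin{pmatrix}0&0&0\\0&0&1\\1&0&0\end{pmatrix}.$$ Moreover, two hom-Lie algebras $(\mathfrak{h}_3(\mathbb{C}),A_i)$ and $(\mathfrak{h}_3(\mathbb{C}),A_j)$ are isomorphic if and only if $A_i=A_j$.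
   Context: A complex hom-Lie algebra is a triple $(V,\cdot,A)$, where $V$ is a complex vector space, $\cdot$ is a skew-symmetric bilinear product on $V$, and $A:V\to V$ is a linear map (the twisting map) satisfying the hom-Jacobi identity $$\sum_{\sigma\in S_3}\operatorname{sign}(\sigma)\,Ax_{\sigma(1)}\cdot(x_{\sigma(2)}\cdot x_{\sigma(3)})=0\quad\text{for all }x_1,x_2,x_3\in V.$$ For a Lie algebra $\mathfrak{g}$, a hom-Lie algebra $(\mathfrak{g},A)$ is one whose product is the Lie bracket of $\mathfrak{g}$. An isomorphism of hom-Lie algebras $(V,\cdot,A)\to(U,\ast,B)$ is an invertible linear map $g:V\to U$ with $g(x\cdot y)=(gx)\ast(gy)$ for all $x,y\in V$ and $g\circ A=B\circ g$. In the matrix of a linear map, the $j$-th column is the coordinate vector of the image of $e_j$. *)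

theory Defs
  imports "HOL-Analysis.Analysis"
begin

(* The vectors x_1, x_2, x_3 of the hom-Jacobi identity are the values at 1, 2, 3
   of a function x on the naturals. *)
locale hom_lie_algebra = vector_space scale
  for scale :: "complex \<Rightarrow> 'a::ab_group_add \<Rightarrow> 'a" +
  fixes mult :: "'a \<Rightarrow> 'a \<Rightarrow> 'a"
    and twist :: "'a \<Rightarrow> 'a"
  assumes linear_mult_right: "\<And>x. Vector_Spaces.linear scale scale (\<lambda>y. mult x y)"
    and linear_mult_left: "\<And>y. Vector_Spaces.linear scale scale (\<lambda>x. mult x y)"
    and skew_symmetric: "\<And>x y. mult x y = - mult y x"
    and linear_twist: "Vector_Spaces.linear scale scale twist"
    and hom_Jacobi: "\<And>x :: nat \<Rightarrow> 'a.
      (\<Sum>\<sigma> | \<sigma> permutes {1, 2, 3}.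
        scale (of_int (sign \<sigma>)) (mult (twist (x (\<sigma> 1))) (mult (x (\<sigma> 2)) (x (\<sigma> 3))))) = 0"

definition hom_lie_isomorphism ::
  "(complex \<Rightarrow> 'a::ab_group_add \<Rightarrow> 'a) \<Rightarrow> ('a \<Rightarrow> 'a \<Rightarrow> 'a) \<Rightarrow> ('a \<Rightarrow> 'a) \<Rightarrow>
   (complex \<Rightarrow> 'b::ab_group_add \<Rightarrow> 'b) \<Rightarrow> ('b \<Rightarrow> 'b \<Rightarrow> 'b) \<Rightarrow> ('b \<Rightarrow> 'b) \<Rightarrow> ('a \<Rightarrow> 'b) \<Rightarrow> bool" where
  "hom_lie_isomorphism scale1 prod1 A scale2 prod2 B g \<longleftrightarrow>
     Vector_Spaces.linear scale1 scale2 g \<and> bij g \<and>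
     (\<forall>x y. g (prod1 x y) = prod2 (g x) (g y)) \<and> g \<circ> A = B \<circ> g"

definition nilpotent_operator :: "('a::zero \<Rightarrow> 'a) \<Rightarrow> bool" where
  "nilpotent_operator A \<longleftrightarrow> (\<exists>n. \<forall>x. (A ^^ n) x = 0)"

definition heis_bracket :: "complex^3 \<Rightarrow> complex^3 \<Rightarrow> complex^3" where
  "heis_bracket x y = (x $ 1 * y $ 2 - x $ 2 * y $ 1) *s axis 3 1"

lemma heis_bracket_basis:
  "heis_bracket (axis 1 1) (axis 2 1) = axis 3 1"
  "heis_bracket (axis 1 1) (axis 3 1) = 0"
  "heis_bracket (axis 2 1) (axis 3 1) = 0"
  by (simp_all add: heis_bracket_def axis_def vec_eq_iff)

lemma heis_bracket_skew: "heis_bracket x y = - heis_bracket y x"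
  by (simp add: heis_bracket_def vec_eq_iff algebra_simps)

lemma heis_bracket_linear:
  "Vector_Spaces.linear (*s) (*s) (heis_bracket x)"
  "Vector_Spaces.linear (*s) (*s) (\<lambda>x. heis_bracket x y)"
  by (unfold_locales; simp add: heis_bracket_def vec_eq_iff algebra_simps)+

lemma heis_bracket_Jacobi:
  "heis_bracket x (heis_bracket y z) + heis_bracket y (heis_bracket z x)
     + heis_bracket z (heis_bracket x y) = 0"
  by (simp add: heis_bracket_def axis_def vec_eq_iff)

abbreviation heis_hom_lie :: "(complex^3 \<Rightarrow> complex^3) \<Rightarrow> bool" where
  "heis_hom_lie A \<equiv> hom_lie_algebra (*s) heis_bracket A"

definition heis_isomorphic :: "(complex^3 \<Rightarrow> complex^3) \<Rightarrow> (complex^3 \<Rightarrow> complex^3) \<Rightarrow> bool" where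
  "heis_isomorphic A B \<longleftrightarrow>
     (\<exists>g. hom_lie_isomorphism (*s) heis_bracket A (*s) heis_bracket B g)"

(* The inner vectors are the rows of the matrices. *)
definition heis_twist :: "nat \<Rightarrow> complex^3^3" where
  "heis_twist i =
    [0,
     vector [vector [0, 0, 0], vector [0, 0, 0], vector [0, 1, 0]],
     vector [vector [0, 1, 0], vector [0, 0, 0], vector [0, 0, 0]],
     vector [vector [0, 0, 0], vector [0, 0, 1], vector [0, 0, 0]],
     vector [vector [0, 1, 0], vector [0, 0, 1], vector [0, 0, 0]],
     vector [vector [0, 0, 0], vector [1, 0, 0], vector [0, 1, 0]],
     vector [vector [0, 0, 0], vector [0, 0, 1], vector [1, 0, 0]]] ! i"

end

theory Submission imports Defs begin

text \<open>
  Since \<open>[x, [y, w]] = 0\<close> in the Heisenberg algebra, the hom-Jacobi identity holds for every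
  linear twist, so the task is to classify nilpotent operators \<open>A\<close> on \<open>\<complex>\<^sup>3\<close> up to conjugation
  by automorphisms of the bracket. These automorphisms preserve the centre, the line spanned by
  \<open>z = e\<^sub>3\<close>; what matters besides the Jordan type of \<open>A\<close> is the position of that line
  relative to the kernels and images of the powers of \<open>A\<close>.

  Existence. By \<open>isomorphic_if_adapted_basis\<close>, \<open>A\<close> is isomorphic to a matrix \<open>M\<close> as soon as it
  acts like \<open>M\<close> on vectors \<open>f\<^sub>1, f\<^sub>2, f\<^sub>3\<close> with \<open>[f\<^sub>1, f\<^sub>2] = f\<^sub>3 \<noteq> 0\<close>; that they form a
  basis is automatic. Nilpotency enters only through \<open>A\<^sup>3 = 0\<close>. If \<open>A\<^sup>2 \<noteq> 0\<close>, then \<open>A\<close> is a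
  single Jordan block with flag \<open>ker A \<subset> ker A\<^sup>2\<close>, and \<open>z\<close> lies in \<open>ker A\<close>, or in \<open>ker A\<^sup>2\<close>
  only, or outside both; this gives the types 5, 6 and 4. The members of a Jordan chain through
  \<open>z\<close> satisfy \<open>[f\<^sub>1, f\<^sub>2] = c f\<^sub>3\<close> with \<open>c \<noteq> 0\<close>, and because the bracket is quadratic,
  rescaling the whole chain by \<open>1/c\<close> makes the constant 1. If \<open>A\<^sup>2 = 0 \<noteq> A\<close>, then \<open>A\<close> has rank one:
  either \<open>A z \<noteq> 0\<close> (type 3), or \<open>A z = 0\<close> and the image of \<open>A\<close> is the centre (type 1) or not
  (type 2).

  Distinctness. An isomorphism preserves the centre, so the vanishing of \<open>A\<close> and \<open>A\<^sup>2\<close>, on the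
  whole space or on the centre, and the inclusion of the image of \<open>A\<close> in the centre are
  invariants; they separate the seven matrices (\<open>inj_on_heis_signature_twist\<close>).
\<close>

section \<open>Bracket and centre of the Heisenberg algebra\<close>

lemma heis_bracket_eq_scale_iff:
  "heis_bracket x y = c *s axis 3 1 \<longleftrightarrow> x $ 1 * y $ 2 - x $ 2 * y $ 1 = c"
  by (simp add: heis_bracket_def vec_eq_iff forall_3 axis_def)

lemma heis_bracket_eq_0_iff: "heis_bracket x y = 0 \<longleftrightarrow> x $ 1 * y $ 2 = x $ 2 * y $ 1"
  using heis_bracket_eq_scale_iff[of x y 0] by simp

definition heis_centre :: "(complex^3) set" where
  "heis_centre = {x. \<forall>y. heis_bracket x y = 0}"

lemma heis_centre_iff: "x \<in> heis_centre \<longleftrightarrow> x $ 1 = 0 \<and> x $ 2 = 0"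
proof
  assume "x \<in> heis_centre"
  then have "heis_bracket x (axis 1 1) = 0" "heis_bracket x (axis 2 1) = 0"
    by (auto simp: heis_centre_def)
  then show "x $ 1 = 0 \<and> x $ 2 = 0"
    by (simp add: heis_bracket_eq_0_iff axis_def)
qed (simp add: heis_centre_def heis_bracket_def)

lemma heis_centre_eq_range: "heis_centre = range (\<lambda>c. c *s axis 3 1)"
proof -
  have "x = x $ 3 *s axis 3 1" if "x \<in> heis_centre" for x
    using that by (simp add: heis_centre_iff vec_eq_iff forall_3 axis_def)
  moreover have "c *s axis 3 1 \<in> heis_centre" for c
    by (simp add: heis_centre_iff axis_def)
  ultimately show ?thesis by blast
qed

lemma heis_bracket_scale:
  "heis_bracket (a *s x) (b *s y) = (a * b) *s heis_bracket x y"
  by (simp add: heis_bracket_def vec_eq_iff algebra_simps)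

lemma heis_bracket_eq_scaleE:
  obtains c where "heis_bracket x y = c *s axis 3 1"
  using that heis_bracket_def by blast

lemma heis_bracket_onto_centre:
  assumes "v \<notin> heis_centre"
  obtains u where "heis_bracket u v = axis 3 1"
proof (cases "v $ 2 = 0")
  case True
  then have "v $ 1 \<noteq> 0" using assms by (simp add: heis_centre_iff)
  then have "heis_bracket (axis 2 (- 1 / v $ 1)) v = axis 3 1"
    by (simp add: heis_bracket_def axis_def vec_eq_iff)
  then show ?thesis by (rule that)
next
  case False
  then have "heis_bracket (axis 1 (1 / v $ 2)) v = axis 3 1"
    by (simp add: heis_bracket_def axis_def vec_eq_iff)
  then show ?thesis by (rule that)
qed

text \<open>The bracket is pulled back from a symplectic form on the two-dimensional quotient by the
  centre, so two vectors commute only if they are linearly dependent modulo the centre.\<close>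
lemma heis_bracket_eq_0E:
  assumes "heis_bracket x y = 0"
  obtains p q r where "p \<noteq> 0 \<or> q \<noteq> 0" "p *s x + q *s y = r *s axis 3 1"
proof (cases "x \<in> heis_centre")
  case True
  then obtain r where "x = r *s axis 3 1" by (auto simp: heis_centre_eq_range)
  then show ?thesis using that[of 1 0 r] by simp
next
  case False
  then obtain i where i: "x $ i \<noteq> 0" "i = 1 \<or> i = 2" by (auto simp: heis_centre_iff)
  have "x $ 1 * y $ 2 = x $ 2 * y $ 1"
    using assms by (simp add: heis_bracket_eq_0_iff)
  then have "y $ i *s x + (- x $ i) *s y \<in> heis_centre"
    using i by (auto simp: heis_centre_iff mult.commute)
  then obtain r where "y $ i *s x + (- x $ i) *s y = r *s axis 3 1"
    by (auto simp: heis_centre_eq_range)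
  then show ?thesis using that[of "y $ i" "- x $ i" r] i by simp
qed

text \<open>Non-commuting vectors form a basis modulo the centre. The coefficients \<open>a\<close> and \<open>b\<close> are given
  by Cramer's rule, with the bracket as determinant.\<close>
lemma heis_bracket_basisE:
  assumes "heis_bracket u v = c *s axis 3 1" "c \<noteq> 0"
  obtains a b d where "x = a *s u + b *s v + d *s axis 3 1"
proof -
  define a where "a = (x $ 1 * v $ 2 - x $ 2 * v $ 1) / c"
  define b where "b = (u $ 1 * x $ 2 - u $ 2 * x $ 1) / c"
  have c: "c = u $ 1 * v $ 2 - u $ 2 * v $ 1"
    using assms by (simp add: heis_bracket_eq_scale_iff)
  have "x - (a *s u + b *s v) \<in> heis_centre"
    using assms(2) by (simp add: heis_centre_iff a_def b_def field_simps)
      (simp add: c algebra_simps)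
  then obtain d where "x - (a *s u + b *s v) = d *s axis 3 1"
    by (auto simp: heis_centre_eq_range)
  then show ?thesis using that[of a b d] by (simp add: algebra_simps)
qed

section \<open>Hom-Lie structures and their isomorphisms\<close>

text \<open>Every summand of the hom-Jacobi identity is a bracket with a commutator, hence with a central
  element, and so vanishes.\<close>
lemma heis_hom_lie_iff_linear:
  "heis_hom_lie A \<longleftrightarrow> Vector_Spaces.linear (*s) (*s) A"
proof
  assume "Vector_Spaces.linear (*s) (*s) A"
  moreover have "heis_bracket x (heis_bracket y w) = 0" for x y w
    by (simp add: heis_bracket_def axis_def vec_eq_iff)
  ultimately show "heis_hom_lie A"
    by (intro hom_lie_algebra.intro hom_lie_algebra_axioms.intro heis_bracket_linear
        heis_bracket_skew) (simp_all add: vec.vector_space_axioms)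
qed (rule hom_lie_algebra.linear_twist)

lemma hom_lie_isomorphism_inv:
  fixes A B :: "complex^3 \<Rightarrow> complex^3"
  assumes "hom_lie_isomorphism (*s) heis_bracket A (*s) heis_bracket B g"
  shows "hom_lie_isomorphism (*s) heis_bracket B (*s) heis_bracket A (inv g)"
proof -
  have lin: "Vector_Spaces.linear (*s) (*s) g" and bij: "bij g"
    and br: "\<And>x y. g (heis_bracket x y) = heis_bracket (g x) (g y)"
    and tw: "\<And>x. g (A x) = B (g x)"
    using assms by (auto simp: hom_lie_isomorphism_def fun_eq_iff)
  have gi: "g (inv g x) = x" for x using bij by (simp add: bij_is_surj surj_f_inv_f)
  have ig: "inv g (g x) = x" for x using bij by (simp add: bij_is_inj)
  have "Vector_Spaces.linear (*s) (*s) (inv g)"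
    by (rule vec.inj_linear_imp_inv_linear[OF lin bij_is_inj[OF bij]])
  moreover have "inv g (heis_bracket x y) = heis_bracket (inv g x) (inv g y)" for x y
    by (metis br gi ig)
  moreover have "inv g (B x) = A (inv g x)" for x by (metis tw gi ig)
  ultimately show ?thesis
    using bij by (simp add: hom_lie_isomorphism_def bij_imp_bij_inv fun_eq_iff)
qed

lemma heis_isomorphic_refl: "heis_isomorphic A A"
  unfolding heis_isomorphic_def hom_lie_isomorphism_def
  by (rule exI[of _ id]) (auto simp: vec.linear_id)

text \<open>The linear map \<open>h\<close> sending \<open>e\<^sub>i\<close> to \<open>f\<^sub>i\<close> is an isomorphism from the hom-Lie algebra of \<open>M\<close>
  to that of \<open>A\<close>. It is multiplicative because \<open>f\<^sub>3\<close>, being a bracket, is central. It is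
  injective because its kernel is closed under brackets with arbitrary vectors, and \<open>h\<close> is
  injective on the centre.\<close>
lemma isomorphic_if_adapted_basis:
  fixes M :: "complex^3^3"
  assumes lin: "Vector_Spaces.linear (*s) (*s) A"
    and f3: "heis_bracket f1 f2 = f3" "f3 \<noteq> 0"
    and A1: "A f1 = M $ 1 $ 1 *s f1 + M $ 2 $ 1 *s f2 + M $ 3 $ 1 *s f3"
    and A2: "A f2 = M $ 1 $ 2 *s f1 + M $ 2 $ 2 *s f2 + M $ 3 $ 2 *s f3"
    and A3: "A f3 = M $ 1 $ 3 *s f1 + M $ 2 $ 3 *s f2 + M $ 3 $ 3 *s f3"
  shows "heis_isomorphic A (\<lambda>x. M *v x)"
proof -
  define h where "h x = x $ 1 *s f1 + x $ 2 *s f2 + x $ 3 *s f3" for x :: "complex^3"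
  have linh: "Vector_Spaces.linear (*s) (*s) h"
    by unfold_locales (simp_all add: h_def vec_eq_iff algebra_simps)
  obtain c where c: "f3 = c *s axis 3 1"
    using heis_bracket_eq_scaleE f3(1) by metis
  have brh: "heis_bracket (h x) (h y) = h (heis_bracket x y)" for x y
  proof -
    have "heis_bracket (h x) (h y) = (x $ 1 * y $ 2 - x $ 2 * y $ 1) *s heis_bracket f1 f2"
      by (simp add: heis_bracket_def h_def c axis_def vec_eq_iff algebra_simps)
    also have "\<dots> = h (heis_bracket x y)"
      by (simp add: f3 h_def) (simp add: heis_bracket_def axis_def)
    finally show ?thesis .
  qed
  have "x = 0" if "h x = 0" for x
  proof -
    have "h (heis_bracket x y) = 0" for y
      unfolding brh[symmetric] that by (simp add: heis_bracket_def)
    then have "heis_bracket x y = 0" for y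
      using f3(2) by (simp add: h_def heis_bracket_def axis_def)
    then have "x \<in> heis_centre" by (simp add: heis_centre_def)
    then have "x $ 1 = 0" "x $ 2 = 0" by (simp_all add: heis_centre_iff)
    moreover from this have "x $ 3 = 0" using that f3(2) by (simp add: h_def)
    ultimately show "x = 0" by (simp add: vec_eq_iff forall_3)
  qed
  then have inj: "inj h" using vec.linear_inj_iff_eq_0[OF linh] by blast
  then have "bij h" using vec.linear_injective_imp_surjective[OF linh inj] by (simp add: bij_def)
  moreover have "h (M *v x) = A (h x)" for x
    by (simp add: h_def vec.linear_add[OF lin] vec.linear_scale[OF lin] A1 A2 A3
        matrix_vector_mult_def sum_3 vec_eq_iff algebra_simps)
  ultimately have "hom_lie_isomorphism (*s) heis_bracket (\<lambda>x. M *v x) (*s) heis_bracket A h"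
    using linh brh by (simp add: hom_lie_isomorphism_def fun_eq_iff)
  then show ?thesis
    unfolding heis_isomorphic_def by (blast dest: hom_lie_isomorphism_inv)
qed

section \<open>Nilpotent operators in dimension three\<close>

lemma Jordan_chain_independent:
  fixes A :: "complex^3 \<Rightarrow> complex^3"
  assumes lin: "Vector_Spaces.linear (*s) (*s) A"
    and y: "A (A y) \<noteq> 0" "A (A (A y)) = 0"
    and eq: "a *s y + b *s A y + c *s A (A y) = 0"
  shows "a = 0 \<and> b = 0 \<and> c = 0"
proof -
  note [simp] = vec.linear_add[OF lin] vec.linear_scale[OF lin] vec.linear_0[OF lin]
  have "A (A (a *s y + b *s A y + c *s A (A y))) = 0" unfolding eq by simp
  then have a: "a = 0" using y by simp
  have "A (a *s y + b *s A y + c *s A (A y)) = 0" unfolding eq by simp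
  then have "b = 0" using y a by simp
  then show ?thesis using eq y a by simp
qed

lemma Jordan_chain_spans:
  fixes A :: "complex^3 \<Rightarrow> complex^3"
  assumes lin: "Vector_Spaces.linear (*s) (*s) A"
    and y: "A (A y) \<noteq> 0" "A (A (A y)) = 0"
  obtains a b c where "x = a *s y + b *s A y + c *s A (A y)"
proof -
  define h where "h v = v $ 1 *s y + v $ 2 *s A y + v $ 3 *s A (A y)" for v :: "complex^3"
  have linh: "Vector_Spaces.linear (*s) (*s) h"
    by unfold_locales (simp_all add: h_def vec_eq_iff algebra_simps)
  have "v = 0" if "h v = 0" for v
    using Jordan_chain_independent[OF lin y, of "v $ 1" "v $ 2" "v $ 3"] that
    by (simp add: h_def vec_eq_iff forall_3)
  then have inj: "inj h" using vec.linear_inj_iff_eq_0[OF linh] by blast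
  then have "surj h" using vec.linear_injective_imp_surjective[OF linh inj] by simp
  then obtain v where "x = h v" by (rule surjE)
  then show ?thesis using that h_def by blast
qed

text \<open>If the nilpotency index \<open>n\<close> exceeded 3, some vector \<open>w\<close> would have
  \<open>A\<^bsup>n-1\<^esup> w \<noteq> 0\<close>. The last three nonzero members of its orbit form a Jordan chain of
  length three, which spans the space and is killed by \<open>A\<^sup>3\<close>.\<close>
lemma nilpotent_cube_eq_0:
  fixes A :: "complex^3 \<Rightarrow> complex^3"
  assumes lin: "Vector_Spaces.linear (*s) (*s) A" and nil: "nilpotent_operator A"
  shows "A (A (A x)) = 0"
proof -
  note [simp] = vec.linear_add[OF lin] vec.linear_scale[OF lin] vec.linear_0[OF lin]
  define n where "n = (LEAST n. \<forall>x. (A ^^ n) x = 0)"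
  have n: "(A ^^ n) x = 0" for x
    using nil LeastI_ex[of "\<lambda>n. \<forall>x. (A ^^ n) x = 0"]
    by (simp add: nilpotent_operator_def n_def)
  have min: "\<exists>x. (A ^^ k) x \<noteq> 0" if "k < n" for k
    using not_less_Least[of k] that unfolding n_def by blast
  show ?thesis
  proof (cases "n \<le> 3")
    case True
    then have "(A ^^ 3) x = (A ^^ (3 - n)) ((A ^^ n) x)"
      by (simp flip: comp_apply[of "A ^^ _"] funpow_add)
    also have "(A ^^ k) 0 = 0" for k by (induction k) auto
    then have "(A ^^ (3 - n)) ((A ^^ n) x) = 0" by (simp add: n)
    finally show ?thesis by (simp add: numeral_3_eq_3)
  next
    case False
    then obtain m where m: "n = Suc (Suc (Suc m))"
      by (metis add_2_eq_Suc' add_Suc_right le_add_diff_inverse2 nat_le_linear numeral_3_eq_3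
          add.right_neutral)
    obtain w where "(A ^^ Suc (Suc m)) w \<noteq> 0" using min[of "Suc (Suc m)"] m by auto
    then have y: "A (A ((A ^^ m) w)) \<noteq> 0" "A (A (A ((A ^^ m) w))) = 0"
      using n[of w] by (simp_all add: m)
    obtain a b c where
      "x = a *s (A ^^ m) w + b *s A ((A ^^ m) w) + c *s A (A ((A ^^ m) w))"
      by (rule Jordan_chain_spans[OF lin y])
    then show ?thesis using y by simp
  qed
qed

section \<open>Invariants separating the normal forms\<close>

text \<open>Every entry is phrased in terms of the centre rather than of the vector \<open>e\<^sub>3\<close>, so that
  invariance under isomorphism is evident.\<close>
definition heis_signature :: "(complex^3 \<Rightarrow> complex^3) \<Rightarrow> bool list" where
  "heis_signature A =
    [\<forall>x. A x = 0, \<forall>x. A (A x) = 0, \<forall>x. A x \<in> heis_centre,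
     \<forall>x\<in>heis_centre. A x = 0, \<forall>x\<in>heis_centre. A (A x) = 0]"

lemma heis_signature_cong:
  assumes "heis_isomorphic A B"
  shows "heis_signature A = heis_signature B"
proof -
  obtain g where lin: "Vector_Spaces.linear (*s) (*s) g" and bij: "bij g"
    and br: "\<And>x y. g (heis_bracket x y) = heis_bracket (g x) (g y)"
    and tw: "\<And>x. B (g x) = g (A x)"
    using assms by (auto simp: heis_isomorphic_def hom_lie_isomorphism_def fun_eq_iff)
  have 0: "g x = 0 \<longleftrightarrow> x = 0" for x
    using bij vec.linear_0[OF lin] by (metis bij_is_inj injD)
  have all: "(\<forall>y. P y) \<longleftrightarrow> (\<forall>x. P (g x))" for P
    using bij by (metis bij_is_surj surjD)
  have centre: "g x \<in> heis_centre \<longleftrightarrow> x \<in> heis_centre" for x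
    by (simp add: heis_centre_def all[of "\<lambda>y. heis_bracket (g x) y = 0"] 0 flip: br)
  show ?thesis
    by (simp add: heis_signature_def Ball_def all[of "\<lambda>y. B y = 0"] all[of "\<lambda>y. B (B y) = 0"]
        all[of "\<lambda>y. B y \<in> heis_centre"] all[of "\<lambda>y. y \<in> heis_centre \<longrightarrow> B y = 0"]
        all[of "\<lambda>y. y \<in> heis_centre \<longrightarrow> B (B y) = 0"] tw 0 centre)
qed

lemma heis_signature_linear:
  assumes lin: "Vector_Spaces.linear (*s) (*s) A"
  shows "heis_signature A =
    [\<forall>x. A x = 0, \<forall>x. A (A x) = 0, \<forall>x. A x \<in> heis_centre,
     A (axis 3 1) = 0, A (A (axis 3 1)) = 0]"
proof -
  have "(\<forall>x\<in>heis_centre. A x = 0) \<longleftrightarrow> A (axis 3 1) = 0"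
    "(\<forall>x\<in>heis_centre. A (A x) = 0) \<longleftrightarrow> A (A (axis 3 1)) = 0"
    by (auto simp: heis_centre_eq_range vec.linear_scale[OF lin] dest: spec[of _ 1])
  then show ?thesis by (simp add: heis_signature_def)
qed

lemma heis_twist_mult:
  "heis_twist 0 *v x = 0"
  "heis_twist 1 *v x = vector [0, 0, x $ 2]"
  "heis_twist 2 *v x = vector [x $ 2, 0, 0]"
  "heis_twist 3 *v x = vector [0, x $ 3, 0]"
  "heis_twist 4 *v x = vector [x $ 2, x $ 3, 0]"
  "heis_twist 5 *v x = vector [0, x $ 1, x $ 2]"
  "heis_twist 6 *v x = vector [0, x $ 3, x $ 1]"
  by (simp_all add: heis_twist_def matrix_vector_mult_def vec_eq_iff sum_3 forall_3)

lemma heis_signature_twist: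
  "heis_signature (\<lambda>x. heis_twist 0 *v x) = [True, True, True, True, True]"
  "heis_signature (\<lambda>x. heis_twist 1 *v x) = [False, True, True, True, True]"
  "heis_signature (\<lambda>x. heis_twist 2 *v x) = [False, True, False, True, True]"
  "heis_signature (\<lambda>x. heis_twist 3 *v x) = [False, True, False, False, True]"
  "heis_signature (\<lambda>x. heis_twist 4 *v x) = [False, False, False, False, False]"
  "heis_signature (\<lambda>x. heis_twist 5 *v x) = [False, False, False, True, True]"
  "heis_signature (\<lambda>x. heis_twist 6 *v x) = [False, False, False, False, True]"
  unfolding heis_signature_linear[OF matrix_vector_mul_linear_gen]
  unfolding heis_twist_mult
  by (auto simp: heis_centre_iff
      vec_eq_iff[of _ 0] forall_3 axis_def intro!: exI[of _ "vec 1"])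

lemma inj_on_heis_signature_twist:
  "inj_on (\<lambda>i. heis_signature (\<lambda>x. heis_twist i *v x)) {0..6}"
proof -
  have "{0..6::nat} = {0, 1, 2, 3, 4, 5, 6}" by auto
  then show ?thesis
    by (simp only:) (simp add: heis_signature_twist[unfolded One_nat_def])
qed

section \<open>Reduction to normal form\<close>

text \<open>The cases follow the position of the image and the kernel of \<open>A\<close>, a line and a plane if
  \<open>A \<noteq> 0\<close>, relative to the centre.\<close>
lemma isomorphic_if_square_eq_0:
  assumes lin: "Vector_Spaces.linear (*s) (*s) A" and sq: "\<And>x. A (A x) = 0"
  shows "\<exists>i\<in>{0..3}. heis_isomorphic A (\<lambda>x. heis_twist i *v x)"
proof -
  note [simp] = vec.linear_add[OF lin] vec.linear_scale[OF lin] vec.linear_0[OF lin]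
    vec.linear_diff[OF lin]
  let ?z = "axis 3 1 :: complex^3"
  consider "\<forall>x. A x = 0" | "A ?z \<noteq> 0"
    | "A ?z = 0" "\<exists>x. A x \<notin> heis_centre"
    | "A ?z = 0" "\<forall>x. A x \<in> heis_centre" "\<exists>x. A x \<noteq> 0" by blast
  then show ?thesis
  proof cases
    case 1
    then have "A = (\<lambda>x. heis_twist 0 *v x)" by (simp add: fun_eq_iff heis_twist_mult)
    then show ?thesis using heis_isomorphic_refl by force
  next
    case 2
    have "A ?z \<notin> heis_centre"
    proof
      assume "A ?z \<in> heis_centre"
      then obtain c where "A ?z = c *s ?z" by (auto simp: heis_centre_eq_range)
      with sq[of ?z] 2 show False by simp
    qed
    then obtain w where w: "heis_bracket w (A ?z) = ?z" by (rule heis_bracket_onto_centre)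
    obtain a b c where Aw: "A w = a *s w + b *s A ?z + c *s ?z"
      using heis_bracket_basisE[of w "A ?z" 1 "A w"] w by auto
    have "a *s A w + c *s A ?z = 0" using arg_cong[OF Aw, of A] by (simp add: sq)
    \<comment> \<open>Applying \<open>A\<close> to this expansion shows that the image of \<open>A\<close> is a line. This permits correcting \<open>w\<close> by a multiple of \<open>z\<close> so that it
      lies in the kernel of \<open>A\<close>.\<close>
    obtain k where k: "A w = k *s A ?z"
    proof (cases "a = 0")
      case True
      then have "c = 0" using \<open>a *s A w + c *s A ?z = 0\<close> 2 by simp
      then show ?thesis using that[of b] Aw True by simp
    next
      case False
      then have "A w = (- c / a) *s A ?z"
        using \<open>a *s A w + c *s A ?z = 0\<close>
        by (simp add: vec_eq_iff field_simps eq_neg_iff_add_eq_0)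
      then show ?thesis by (rule that)
    qed
    have "heis_isomorphic A (\<lambda>x. heis_twist 3 *v x)"
    proof (rule isomorphic_if_adapted_basis[OF lin])
      show "heis_bracket (w - k *s ?z) (A ?z) = ?z"
        using w by (simp add: heis_bracket_def axis_def)
    qed (simp_all add: heis_twist_def sq k)
    then show ?thesis by force
  next
    case 3
    then obtain x where x: "A x \<notin> heis_centre" by blast
    obtain c where c: "heis_bracket (A x) x = c *s ?z" by (rule heis_bracket_eq_scaleE)
    \<comment> \<open>If \<open>x\<close> and \<open>A x\<close> commuted, they would be dependent modulo the centre, and applying \<open>A\<close>,
      which kills \<open>A x\<close> and \<open>z\<close>, would put \<open>A x\<close> into the centre.\<close>
    have "c \<noteq> 0"
    proof
      assume "c = 0"
      then obtain p q r where pq: "p \<noteq> 0 \<or> q \<noteq> 0" "p *s A x + q *s x = r *s ?z"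
        using heis_bracket_eq_0E c by (metis vec.scale_zero_left)
      from arg_cong[OF this(2), of A] have "q *s A x = 0" by (simp add: 3 sq)
      with x have q: "q = 0" by (auto simp: heis_centre_iff)
      with pq have "p \<noteq> 0" "p *s A x \<in> heis_centre" by (auto simp: heis_centre_eq_range)
      with x show False by (simp add: heis_centre_iff)
    qed
    have "heis_isomorphic A (\<lambda>x. heis_twist 2 *v x)"
      by (rule isomorphic_if_adapted_basis[OF lin c])
        (simp_all add: heis_twist_def sq 3 \<open>c \<noteq> 0\<close>)
    then show ?thesis by force
  next
    case 4
    then obtain u where u: "A u \<noteq> 0" by blast
    then have "u \<notin> heis_centre" using 4 by (auto simp: heis_centre_eq_range)
    then obtain w where w: "heis_bracket w u = ?z" by (rule heis_bracket_onto_centre)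
    obtain c where c: "A u = c *s ?z" using 4 by (auto simp: heis_centre_eq_range)
    obtain d where d: "A w = d *s ?z" using 4 by (auto simp: heis_centre_eq_range)
    have "heis_isomorphic A (\<lambda>x. heis_twist 1 *v x)"
    proof (rule isomorphic_if_adapted_basis[OF lin])
      \<comment> \<open>The combination of \<open>w\<close> and \<open>u\<close> that \<open>A\<close> kills. Its coefficient at \<open>w\<close> already has the
        right scale, since \<open>A u = c z\<close>.\<close>
      show "heis_bracket (c *s w - d *s u) u = A u"
        using w by (simp add: c heis_bracket_def vec_eq_iff forall_3 axis_def algebra_simps)
    qed (use u in \<open>simp_all add: heis_twist_def sq, simp_all add: c d\<close>)
    then show ?thesis by force
  qed
qed

text \<open>In each case the centre is a member of a Jordan chain of length three: its first member if
  \<open>A\<^sup>2 z \<noteq> 0\<close>, its last if \<open>A z = 0\<close>, and its middle one otherwise. The two other members do not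
  commute, since a linear relation between them modulo \<open>z\<close> would contradict the independence of
  the chain.\<close>
lemma isomorphic_if_square_neq_0:
  assumes lin: "Vector_Spaces.linear (*s) (*s) A" and cube: "\<And>x. A (A (A x)) = 0"
    and x: "A (A x) \<noteq> 0"
  shows "\<exists>i\<in>{4..6}. heis_isomorphic A (\<lambda>x. heis_twist i *v x)"
proof -
  note [simp] = vec.linear_add[OF lin] vec.linear_scale[OF lin] vec.linear_0[OF lin]
    vec.linear_diff[OF lin]
  let ?z = "axis 3 1 :: complex^3"
  have bracket_neq_0: "heis_bracket u v \<noteq> 0"
    if "\<And>p q r. p *s u + q *s v = r *s ?z \<Longrightarrow> p = 0 \<and> q = 0" for u v
    using that heis_bracket_eq_0E by metis
  note indep = Jordan_chain_independent[OF lin _ cube]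
  consider "A (A ?z) \<noteq> 0" | "A ?z = 0" | "A ?z \<noteq> 0" "A (A ?z) = 0" by blast
  then show ?thesis
  proof cases
    case 1
    obtain c where c: "heis_bracket (A (A ?z)) (A ?z) = c *s ?z" by (rule heis_bracket_eq_scaleE)
    have "heis_bracket (A (A ?z)) (A ?z) \<noteq> 0"
    proof (rule bracket_neq_0)
      fix p q r assume "p *s A (A ?z) + q *s A ?z = r *s ?z"
      then have "(- r) *s ?z + q *s A ?z + p *s A (A ?z) = 0" by (simp add: algebra_simps)
      from indep[OF 1 this] show "p = 0 \<and> q = 0" by simp
    qed
    with c have "c \<noteq> 0" by auto
    have "heis_isomorphic A (\<lambda>x. heis_twist 4 *v x)"
    proof (rule isomorphic_if_adapted_basis[OF lin])
      show "heis_bracket ((1 / c) *s A (A ?z)) ((1 / c) *s A ?z) = (1 / c) *s ?z"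
        using \<open>c \<noteq> 0\<close> by (simp add: heis_bracket_scale c)
    qed (simp_all add: heis_twist_def cube \<open>c \<noteq> 0\<close>)
    then show ?thesis by force
  next
    case 2
    \<comment> \<open>The kernel of a single Jordan block is the line spanned by the end of the chain, so that
      line is the centre.\<close>
    obtain k where k: "A (A x) = k *s ?z"
    proof -
      obtain a b c where z: "?z = a *s x + b *s A x + c *s A (A x)"
        by (rule Jordan_chain_spans[OF lin x cube])
      have "0 *s x + a *s A x + b *s A (A x) = 0" using arg_cong[OF z, of A] 2 by (simp add: cube)
      from indep[OF x this] have "?z = c *s A (A x)" using z by simp
      moreover from this have "c \<noteq> 0" by auto
      ultimately have "A (A x) = (1 / c) *s ?z" by simp
      then show ?thesis by (rule that)
    qed
    with x have "k \<noteq> 0" by auto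
    obtain c where c: "heis_bracket x (A x) = c *s ?z" by (rule heis_bracket_eq_scaleE)
    have "heis_bracket x (A x) \<noteq> 0"
    proof (rule bracket_neq_0)
      fix p q r assume "p *s x + q *s A x = r *s ?z"
      from arg_cong[OF this, of A] have "0 *s x + p *s A x + q *s A (A x) = 0" using 2 by simp
      from indep[OF x this] show "p = 0 \<and> q = 0" by simp
    qed
    with c have "c \<noteq> 0" by auto
    have "heis_isomorphic A (\<lambda>x. heis_twist 5 *v x)"
    proof (rule isomorphic_if_adapted_basis[OF lin])
      \<comment> \<open>\<open>[x, A x] = c z\<close> and \<open>A\<^sup>2 x = k z\<close>, so scaling the chain by \<open>t\<close> requires
        \<open>t\<^sup>2 c = t k\<close>.\<close>
      show "heis_bracket ((k / c) *s x) ((k / c) *s A x) = (k / c) *s A (A x)"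
        using \<open>c \<noteq> 0\<close> by (simp add: heis_bracket_scale c k)
    qed (simp_all add: heis_twist_def cube x \<open>c \<noteq> 0\<close> \<open>k \<noteq> 0\<close>)
    then show ?thesis by force
  next
    case 3
    \<comment> \<open>For a single Jordan block the kernel of \<open>A\<^sup>2\<close> is the image of \<open>A\<close>.\<close>
    obtain f where f: "A f = ?z"
    proof -
      obtain a b c where z: "?z = a *s x + b *s A x + c *s A (A x)"
        by (rule Jordan_chain_spans[OF lin x cube])
      have "a *s A (A x) = 0" using arg_cong[OF z, of "\<lambda>x. A (A x)"] 3 by (simp add: cube)
      then have "A (b *s x + c *s A x) = ?z" using x z by simp
      then show ?thesis by (rule that)
    qed
    then have Af: "A (A f) \<noteq> 0" using 3 by simp
    obtain c where c: "heis_bracket f (A ?z) = c *s ?z" by (rule heis_bracket_eq_scaleE)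
    have "heis_bracket f (A ?z) \<noteq> 0"
    proof (rule bracket_neq_0)
      fix p q r assume "p *s f + q *s A ?z = r *s ?z"
      then have "p *s f + (- r) *s A f + q *s A (A f) = 0" by (simp add: f algebra_simps)
      from indep[OF Af this] show "p = 0 \<and> q = 0" by simp
    qed
    with c have "c \<noteq> 0" by auto
    have "heis_isomorphic A (\<lambda>x. heis_twist 6 *v x)"
    proof (rule isomorphic_if_adapted_basis[OF lin])
      show "heis_bracket ((1 / c) *s f) ((1 / c) *s A ?z) = (1 / c) *s ?z"
        using \<open>c \<noteq> 0\<close> by (simp add: heis_bracket_scale c)
    qed (simp_all add: heis_twist_def 3 f \<open>c \<noteq> 0\<close>)
    then show ?thesis by force
  qed
qed

lemma heis_hom_lie_twist: "heis_hom_lie (\<lambda>x. heis_twist i *v x)"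
  by (simp add: heis_hom_lie_iff_linear)

lemma nilpotent_isomorphic_heis_twist:
  assumes "heis_hom_lie A" "nilpotent_operator A"
  shows "\<exists>i\<in>{0..6}. heis_isomorphic A (\<lambda>x. heis_twist i *v x)"
proof -
  have lin: "Vector_Spaces.linear (*s) (*s) A" and cube: "\<And>x. A (A (A x)) = 0"
    using assms by (auto simp: heis_hom_lie_iff_linear nilpotent_cube_eq_0)
  show ?thesis
  proof (cases "\<forall>x. A (A x) = 0")
    case True
    then show ?thesis using isomorphic_if_square_eq_0[OF lin] by fastforce
  next
    case False
    then show ?thesis using isomorphic_if_square_neq_0[OF lin cube] by fastforce
  qed
qed

lemma heis_twist_isomorphic_iff:
  assumes "i \<in> {0..6}" "j \<in> {0..6}"
  shows "heis_isomorphic (\<lambda>x. heis_twist i *v x) (\<lambda>x. heis_twist j *v x) \<longleftrightarrow>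
    heis_twist i = heis_twist j"
  using heis_signature_cong inj_onD[OF inj_on_heis_signature_twist _ assms] heis_isomorphic_refl
  by metis

theorem proposition3p10:
  "(\<forall>i\<in>{0..6}. heis_hom_lie (\<lambda>x. heis_twist i *v x)) \<and>
   (\<forall>A. heis_hom_lie A \<and> nilpotent_operator A \<longrightarrow>
      (\<exists>i\<in>{0..6}. heis_isomorphic A (\<lambda>x. heis_twist i *v x))) \<and>
   (\<forall>i\<in>{0..6}. \<forall>j\<in>{0..6}.
      heis_isomorphic (\<lambda>x. heis_twist i *v x) (\<lambda>x. heis_twist j *v x) \<longleftrightarrow>
      heis_twist i = heis_twist j)"
  using heis_hom_lie_twist nilpotent_isomorphic_heis_twist heis_twist_isomorphic_iff by blast

end
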